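(* For $(\alpha,\beta)\in(0,\frac12)^2$ let $$F(\alpha,\beta)=\frac{\max\{\omega(\alpha,\beta),\omega(\beta,\alpha)\}}{T_{\alpha,\beta}},$$ where $$\omega(\alpha,\beta)=\frac12\left(\alpha\ln\frac{\alpha}{1-\beta}+(1-\alpha)\ln\frac{1-\alpha}{\beta}\right),\qquad T_{\alpha,\beta}=\frac{(\Phi^{-1}(\alpha)+\Phi^{-1}(\beta))^2}{4}.$$ Then: (i) $F(\alpha,\beta)\ge\frac14$ for all $(\alpha,\beta)\in(0,\frac12)^2$; (ii) for every fixed $\alpha\in(0,\frac12)$, $\lim_{\beta\to0}F(\alpha,\beta)=1-\alpha$ (limit from the right); (iii) with $(\alpha,\beta)$ ranging over $(0,\frac12)^2$, $$\liminf_{(\alpha,\beta)\to(0,0)}F(\alpha,\beta)=\frac14<1=\limsup_{(\alpha,\beta)\to(0,0)}F(\alpha,\beta).$$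
   Context: $\Phi$ is the distribution function of the standard normal distribution and $\Phi^{-1}:(0,1)\to\mathbb{R}$ is its inverse. Interpretation: for a process $X_t=\theta t+W_t$ with $W$ a standard Brownian motion and $\theta\in\{-1,1\}$ unknown, one tests $H_1:\theta=1$ against $H_{-1}:\theta=-1$ with a decision $d\in\{-1,1\}$ satisfying $\mathbb{P}_{-1}(d=1)\le\alpha$ and $\mathbb{P}_1(d=-1)\le\beta$, where $\mathbb{P}_a$ is the law under $\theta=a$. Here $T_{\alpha,\beta}$ is the smallest deterministic sample size for which such a test exists, $\omega(\alpha,\beta)$ and $\omega(\beta,\alpha)$ are the expected sample sizes of the sequential probability ratio test under $\mathbb{P}_{-1}$ and $\mathbb{P}_1$ respectively, and $F$ is the relative efficiency under the hypothesis with the largest expected sample size. *)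

theory Defs
  imports "HOL-Probability.Probability"
begin

definition Phi :: "real \<Rightarrow> real" where
  "Phi = cdf std_normal_distribution"

(* Phi is a strictly increasing bijection from the reals onto the open interval (0,1), so inv yields
   its genuine inverse there; values at other arguments are unspecified. *)
definition Phi_inv :: "real \<Rightarrow> real" where
  "Phi_inv = inv Phi"

definition omega :: "real \<Rightarrow> real \<Rightarrow> real" where
  "omega \<alpha> \<beta> = 1 / 2 * (\<alpha> * ln (\<alpha> / (1 - \<beta>)) + (1 - \<alpha>) * ln ((1 - \<alpha>) / \<beta>))"

definition sample_size :: "real \<Rightarrow> real \<Rightarrow> real" where
  "sample_size \<alpha> \<beta> = (Phi_inv \<alpha> + Phi_inv \<beta>)\<^sup>2 / 4"

definition efficiency :: "real \<Rightarrow> real \<Rightarrow> real" where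
  "efficiency \<alpha> \<beta> = max (omega \<alpha> \<beta>) (omega \<beta> \<alpha>) / sample_size \<alpha> \<beta>"

end

theory Submission
  imports Defs "HOL-Real_Asymp.Real_Asymp"
begin

text \<open>Write \<open>L y = ln ((1 - y) / y)\<close>. The two expected sample sizes add up to
  \<open>(1 - \<alpha> - \<beta>) * (L \<alpha> + L \<beta>) / 2\<close>, and Cauchy--Schwarz reduces the lower bound 1/4 to the diagonal
  inequality \<open>(Phi_inv y)\<^sup>2 / 2 \<le> (1 - 2 * y) * L y\<close>. The latter follows from
  \<open>4 * Phi x * Phi (- x) \<le> exp (- x\<^sup>2 / 2)\<close> and \<open>x - 1 \<le> x * ln x\<close>.
  All limits rest on \<open>(Phi_inv y)\<^sup>2 \<sim> 2 * ln (1 / y)\<close>: the value 1/4 is approached along the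
  diagonal, the value 1 by letting \<open>\<beta>\<close> tend to 0 first, and nothing larger is possible because
  \<open>omega \<alpha> \<beta> \<le> ln (1 / \<beta>) / 2\<close> and \<open>sample_size \<alpha> \<beta> \<ge> (Phi_inv \<beta>)\<^sup>2 / 4\<close>.\<close>

section \<open>The standard normal distribution function\<close>

interpretation std_normal: real_distribution std_normal_distribution
  by (rule real_dist_normal_dist)

lemma continuous_on_std_normal_density: "continuous_on S std_normal_density"
  by (auto simp: normal_density_def intro!: continuous_intros)

text \<open>A point is a null set, so the half-open interval produced by \<open>cdf_diff_eq\<close>
  may be closed; the integral over a closed interval is the form to which the fundamental theorem of
  calculus applies.\<close>

lemma Phi_diff_eq_integral:
  assumes "x \<le> y"
  shows "Phi y - Phi x = integral {x..y} std_normal_density"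
proof (cases "x = y")
  case False
  then have "x < y" using assms by simp
  have int: "set_integrable lborel {x..y} std_normal_density"
    by (rule borel_integrable_atLeastAtMost'[OF continuous_on_std_normal_density])
  have "Phi y - Phi x = measure std_normal_distribution {x<..y}"
    unfolding Phi_def using std_normal.cdf_diff_eq[OF \<open>x < y\<close>] by simp
  also have "\<dots> = (LINT z|std_normal_distribution. indicator {x<..y} z)"
    by simp
  also have "\<dots> = (LINT z:{x<..y}|lborel. std_normal_density z)"
    unfolding set_lebesgue_integral_def
    by (subst integral_real_density) (auto simp: mult.commute)
  also have "\<dots> = (LINT z:{x..y}|lborel. std_normal_density z)"
    unfolding set_lebesgue_integral_def
  proof (rule integral_cong_AE)
    show "AE z in lborel. indicator {x<..y} z *\<^sub>R std_normal_density z =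
        indicator {x..y} z *\<^sub>R std_normal_density z"
      using AE_lborel_singleton[of x] by eventually_elim (auto simp: indicator_def)
  qed auto
  also have "\<dots> = integral {x..y} std_normal_density"
    by (rule set_borel_integral_eq_integral(2)[OF int])
  finally show ?thesis .
qed simp

lemma std_normal_density_antimono:
  assumes "0 \<le> x" "x \<le> y"
  shows "std_normal_density y \<le> std_normal_density x"
  using power_mono[OF assms(2,1), of 2] by (simp add: normal_density_def divide_right_mono)

lemma DERIV_Phi: "(Phi has_real_derivative std_normal_density x) (at x)"
proof -
  \<comment> \<open>The base point \<open>x - 1\<close> puts \<open>x\<close> in the interior of the
    interval, so the derivative within the interval is a full one.\<close>
  have "((\<lambda>z. integral {x - 1..z} std_normal_density) has_real_derivative std_normal_density x)
      (at x within {x - 1..x + 1})"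
    by (intro integral_has_real_derivative continuous_on_std_normal_density) auto
  then have "((\<lambda>z. integral {x - 1..z} std_normal_density) has_real_derivative std_normal_density x) (at x)"
    by (simp add: at_within_Icc_at)
  then have "((\<lambda>z. Phi (x - 1) + integral {x - 1..z} std_normal_density)
      has_real_derivative std_normal_density x) (at x)"
    by (auto intro!: derivative_eq_intros)
  moreover have "\<forall>\<^sub>F z in nhds x. Phi (x - 1) + integral {x - 1..z} std_normal_density = Phi z"
  proof -
    have "\<forall>\<^sub>F z in nhds x. x - 1 < z"
      by (rule order_tendstoD(1)[OF filterlim_ident]) simp
    then show ?thesis
    proof eventually_elim
      case (elim z)
      with Phi_diff_eq_integral[of "x - 1" z] show ?case by linarith
    qed
  qed
  ultimately show ?thesis
    by (subst (asm) DERIV_cong_ev) auto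
qed

lemma Phi_at_top: "(Phi \<longlongrightarrow> 1) at_top"
  unfolding Phi_def by (rule std_normal.cdf_lim_at_top_prob)

lemma Phi_at_bot: "(Phi \<longlongrightarrow> 0) at_bot"
  unfolding Phi_def by (rule std_normal.cdf_lim_at_bot)

lemma strict_mono_Phi: "strict_mono Phi"
proof (rule strict_monoI)
  fix x y :: real assume "x < y"
  then show "Phi x < Phi y"
    by (rule DERIV_pos_imp_increasing) (use DERIV_Phi normal_density_pos[of 1 0] in force)
qed

lemma Phi_pos: "0 < Phi x"
proof -
  have "0 \<le> Phi (x - 1)"
    unfolding Phi_def by (rule std_normal.cdf_nonneg)
  also have "\<dots> < Phi x"
    using strict_mono_Phi by (simp add: strict_mono_less)
  finally show ?thesis .
qed

text \<open>The density is even, so \<open>Phi x + Phi (- x)\<close> has derivative 0; its constant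
  value is read off from the limit at infinity.\<close>

lemma Phi_uminus: "Phi (- x) = 1 - Phi x"
proof -
  let ?f = "\<lambda>x. Phi x + Phi (- x)"
  have "(?f has_real_derivative 0) (at z)" for z
  proof -
    have "((\<lambda>z. Phi (- z)) has_real_derivative std_normal_density (- z) * (- 1)) (at z)"
      by (rule DERIV_chain2[OF DERIV_Phi]) (auto intro!: derivative_eq_intros)
    from DERIV_add[OF DERIV_Phi this] show ?thesis
      by (simp add: normal_density_def)
  qed
  then have const: "?f z = ?f x" for z
    by (intro DERIV_isconst_all) auto
  have "(?f \<longlongrightarrow> 1 + 0) at_top"
    by (intro tendsto_add Phi_at_top filterlim_compose[OF Phi_at_bot] filterlim_uminus_at_bot_at_top)
  moreover have "?f = (\<lambda>z. ?f x)"
    using const by (rule ext)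
  ultimately have "((\<lambda>z. ?f x) \<longlongrightarrow> 1 + 0) (at_top :: real filter)"
    by (rule back_subst[where P = "\<lambda>f. (f \<longlongrightarrow> 1 + 0) at_top"])
  then have "?f x = 1"
    by (simp add: tendsto_const_iff)
  then show ?thesis by simp
qed

lemma Phi_0: "Phi 0 = 1 / 2"
  using Phi_uminus[of 0] by simp

section \<open>The quantile function\<close>

lemma Phi_inv_Phi [simp]: "Phi_inv (Phi x) = x"
  unfolding Phi_inv_def by (rule inv_f_f[OF strict_mono_imp_inj_on[OF strict_mono_Phi]])

text \<open>\<open>Phi_inv\<close> is a choice-based inverse, so \<open>y\<close> must be shown to
  be a value of \<open>Phi\<close>; this follows from the limits at both ends and the intermediate
  value theorem.\<close>

lemma Phi_Phi_inv:
  assumes "0 < y" "y < 1"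
  shows "Phi (Phi_inv y) = y"
proof -
  \<comment> \<open>Placing \<open>l\<close> and \<open>u\<close> on opposite sides of 0 gives
    \<open>l \<le> u\<close> for the intermediate value theorem.\<close>
  obtain l where l: "Phi l < y" "l \<le> 0"
    using eventually_conj[OF order_tendstoD(2)[OF Phi_at_bot assms(1)] eventually_le_at_bot[of 0]]
    by (auto dest: eventually_happens simp: trivial_limit_at_bot_linorder)
  obtain u where u: "y < Phi u" "0 \<le> u"
    using eventually_conj[OF order_tendstoD(1)[OF Phi_at_top assms(2)] eventually_ge_at_top[of 0]]
    by (auto dest: eventually_happens simp: trivial_limit_at_top_linorder)
  have "\<exists>x\<ge>l. x \<le> u \<and> Phi x = y"
    using l u by (intro IVT) (auto intro: DERIV_isCont[OF DERIV_Phi])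
  then show ?thesis by auto
qed

lemma Phi_inv_neg:
  assumes "0 < y" "y < 1 / 2"
  shows "Phi_inv y < 0"
  using assms Phi_Phi_inv[of y] Phi_0 strict_mono_less[OF strict_mono_Phi, of "Phi_inv y" 0] by simp

lemma Phi_inv_at_bot: "filterlim Phi_inv at_bot (at_right 0)"
  unfolding filterlim_at_bot
proof
  fix Z
  have "\<forall>\<^sub>F y in at_right 0. y \<in> {0<..<min 1 (Phi Z)}"
    using Phi_pos[of Z] by (intro eventually_at_right_real) simp
  then show "\<forall>\<^sub>F y in at_right 0. Phi_inv y \<le> Z"
  proof eventually_elim
    case (elim y)
    then have "Phi (Phi_inv y) < Phi Z" by (simp add: Phi_Phi_inv)
    then show ?case using strict_mono_Phi by (simp add: strict_mono_less)
  qed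
qed

section \<open>Gaussian tail bounds and growth of the quantile function\<close>

text \<open>The difference of the two sides has derivative \<open>exp (- x\<^sup>2 / 2) * k x\<close> with \<open>k\<close> concave and
  \<open>k 0 = 0\<close>, so it increases from 0 and then decreases to 0.\<close>
lemma Phi_variance_le:
  assumes "0 \<le> x"
  shows "4 * Phi x * Phi (- x) \<le> exp (- x\<^sup>2 / 2)"
proof -
  define g where "g x = exp (- x\<^sup>2 / 2) - 4 * Phi x * (1 - Phi x)" for x :: real
  \<comment> \<open>\<open>c\<close> is four times the density at 0; with it, \<open>k\<close> is
    the derivative of \<open>g\<close> divided by \<open>exp (- x\<^sup>2 / 2)\<close>.\<close>
  define c :: real where "c = 4 / sqrt (2 * pi)"
  define k where "k x = c * (2 * Phi x - 1) - x" for x :: real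
  have g': "(g has_real_derivative exp (- z\<^sup>2 / 2) * k z) (at z)" for z
  proof -
    have density: "std_normal_density z = c / 4 * exp (- z\<^sup>2 / 2)"
      by (simp add: normal_density_def c_def)
    have "(g has_real_derivative exp (- z\<^sup>2 / 2) * (- z) -
        (4 * Phi z * (0 - std_normal_density z) + 4 * std_normal_density z * (1 - Phi z))) (at z)"
      unfolding g_def
      by (rule DERIV_diff DERIV_mult DERIV_cmult DERIV_Phi DERIV_const DERIV_fun_exp
          | rule derivative_eq_intros refl | simp)+
    then show ?thesis
      unfolding density k_def by (rule DERIV_cong) algebra
  qed
  have k': "(k has_real_derivative 2 * c * std_normal_density z - 1) (at z)" for z
    unfolding k_def by (auto intro!: derivative_eq_intros DERIV_Phi)
  have "c > 0" by (simp add: c_def)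
  have k0: "k 0 = 0" by (simp add: k_def Phi_0)
  have conc: "concave_on {0..} k"
    unfolding concave_on_def
  proof (rule convex_on_realI)
    show "((\<lambda>z. - k z) has_real_derivative - (2 * c * std_normal_density z - 1)) (at z)" for z
      by (intro DERIV_minus k')
    show "- (2 * c * std_normal_density z - 1) \<le> - (2 * c * std_normal_density w - 1)"
      if "z \<in> {0..}" "w \<in> {0..}" "z \<le> w" for z w :: real
      using std_normal_density_antimono[of z w] that \<open>c > 0\<close> by simp
  qed simp
  \<comment> \<open>Since \<open>k 0 = 0\<close>, concavity makes \<open>k z / z\<close>
    nonincreasing. Hence \<open>k x \<ge> 0\<close> forces \<open>k \<ge> 0\<close> to the left of
    \<open>x\<close>, and \<open>k x < 0\<close> forces \<open>k \<le> 0\<close> to its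
    right.\<close>
  have scale: "k y * z \<le> k z * y" if "0 \<le> z" "z \<le> y" "0 < y" for z y
  proof -
    have "- k ((1 - z / y) *\<^sub>R 0 + (z / y) *\<^sub>R y) \<le> (1 - z / y) * (- k 0) + (z / y) * (- k y)"
      using conc that unfolding concave_on_def
      by (intro convex_onD[where A = "{0..}"]) auto
    then show ?thesis using that k0 by (simp add: field_simps)
  qed
  have "0 \<le> g x"
  proof (cases "0 < x")
    case True
    show ?thesis
    proof (cases "0 \<le> k x")
      case kx: True
      have "g 0 \<le> g x"
      proof (rule DERIV_nonneg_imp_nondecreasing[OF assms])
        fix z assume z: "0 \<le> z" "z \<le> x"
        have "0 \<le> k x * z" using kx z by simp
        also have "\<dots> \<le> k z * x" using scale z True by simp
        finally have "0 \<le> k z" using True by (simp add: zero_le_mult_iff)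
        then show "\<exists>y. (g has_real_derivative y) (at z) \<and> 0 \<le> y"
          using g'[of z] by (intro exI[of _ "exp (- z\<^sup>2 / 2) * k z"]) auto
      qed
      then show ?thesis by (simp add: g_def Phi_0)
    next
      case kx: False
      \<comment> \<open>Beyond \<open>x\<close> the function \<open>g\<close> decreases, so
        \<open>g x\<close> is at least the limit 0 of \<open>g\<close> at infinity.\<close>
      have "g y \<le> g x" if "x \<le> y" for y
      proof (rule DERIV_nonpos_imp_nonincreasing[OF that])
        fix z assume z: "x \<le> z" "z \<le> y"
        have "k z * x \<le> k x * z" using scale[of x z] z True by simp
        also have "\<dots> \<le> 0" using kx z True by (simp add: mult_nonpos_nonneg)
        finally have "k z \<le> 0" using True by (simp add: mult_le_0_iff)
        then show "\<exists>y. (g has_real_derivative y) (at z) \<and> y \<le> 0"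
          using g'[of z] by (intro exI[of _ "exp (- z\<^sup>2 / 2) * k z"]) (auto simp: mult_nonneg_nonpos)
      qed
      then have "\<forall>\<^sub>F y in at_top. g y \<le> g x"
        by (intro eventually_mono[OF eventually_ge_at_top[of x]]) auto
      moreover have "(g \<longlongrightarrow> 0 - 4 * 1 * (1 - 1)) at_top"
        unfolding g_def
      proof (intro tendsto_diff tendsto_mult tendsto_const Phi_at_top)
        show "((\<lambda>x::real. exp (- x\<^sup>2 / 2)) \<longlongrightarrow> 0) at_top" by real_asymp
      qed
      ultimately show ?thesis
        using tendsto_upperbound[of g 0 at_top "g x"] by simp
    qed
  qed (use assms in \<open>simp add: g_def Phi_0\<close>)
  then show ?thesis by (simp add: g_def Phi_uminus)
qed

lemma Phi_uminus_le:
  assumes "0 \<le> x"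
  shows "Phi (- x) \<le> exp (- x\<^sup>2 / 2) / 2"
proof -
  have "1 / 2 \<le> Phi x"
    using strict_mono_less_eq[OF strict_mono_Phi, of 0 x] assms Phi_0 by simp
  then have "2 * Phi (- x) \<le> 4 * Phi x * Phi (- x)"
    using mult_right_mono[of "1 / 2" "Phi x" "4 * Phi (- x)"] Phi_pos[of "- x"] by (simp add: mult_ac)
  with Phi_variance_le[OF assms] show ?thesis by linarith
qed

text \<open>The tail contains the mass of the interval from \<open>x\<close> to
  \<open>x + 1\<close>, where the density is smallest at the right end. This is crude but precise
  enough on the logarithmic scale.\<close>

lemma Phi_uminus_ge:
  assumes "0 \<le> x"
  shows "std_normal_density (x + 1) \<le> Phi (- x)"
proof -
  obtain z where z: "x < z" "z < x + 1"
      "Phi (x + 1) - Phi x = (x + 1 - x) * std_normal_density z"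
    using MVT2[OF less_add_one[of x] DERIV_Phi] by blast
  have "std_normal_density (x + 1) \<le> std_normal_density z"
    using z assms by (intro std_normal_density_antimono) auto
  also have "\<dots> \<le> 1 - Phi x"
    using z(3) Phi_uminus[of "x + 1"] Phi_pos[of "- (x + 1)"] by simp
  finally show ?thesis by (simp add: Phi_uminus)
qed

text \<open>The two tail bounds differ from \<open>exp (- x\<^sup>2 / 2)\<close> by factors whose
  logarithms grow at most linearly, which vanish after division by \<open>x\<^sup>2\<close>.\<close>

lemma ln_Phi_uminus_asymp: "((\<lambda>x. ln (1 / Phi (- x)) / x\<^sup>2) \<longlongrightarrow> 1 / 2) at_top"
proof (rule tendsto_sandwich)
  show "\<forall>\<^sub>F x in at_top. 1 / 2 \<le> ln (1 / Phi (- x)) / x\<^sup>2"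
    using eventually_gt_at_top[of 0]
  proof eventually_elim
    case (elim x)
    have "Phi (- x) \<le> exp (- x\<^sup>2 / 2) / 2"
      using Phi_uminus_le[of x] elim by simp
    also have "\<dots> \<le> exp (- x\<^sup>2 / 2)" by simp
    finally have "ln (Phi (- x)) \<le> ln (exp (- x\<^sup>2 / 2))"
      using Phi_pos[of "- x"] by (subst ln_le_cancel_iff) auto
    then show ?case using elim Phi_pos[of "- x"] by (simp add: ln_div field_simps)
  qed
  show "\<forall>\<^sub>F x in at_top. ln (1 / Phi (- x)) / x\<^sup>2 \<le> ((x + 1)\<^sup>2 / 2 + ln (sqrt (2 * pi))) / x\<^sup>2"
    using eventually_gt_at_top[of 0]
  proof eventually_elim
    case (elim x)
    have "ln (std_normal_density (x + 1)) \<le> ln (Phi (- x))"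
      using Phi_uminus_ge[of x] elim normal_density_pos[of 1 0 "x + 1"] by simp
    also have "ln (std_normal_density (x + 1)) = - ln (sqrt (2 * pi)) - (x + 1)\<^sup>2 / 2"
      by (simp add: normal_density_def ln_mult ln_div)
    finally show ?case using Phi_pos[of "- x"] by (intro divide_right_mono) (simp_all add: ln_div)
  qed
  show "((\<lambda>x::real. ((x + 1)\<^sup>2 / 2 + ln (sqrt (2 * pi))) / x\<^sup>2) \<longlongrightarrow> 1 / 2) at_top"
  proof -
    have "((\<lambda>x::real. ((x + 1)\<^sup>2 / 2 + c) / x\<^sup>2) \<longlongrightarrow> 1 / 2) at_top" for c :: real
      by real_asymp
    then show ?thesis .
  qed
qed simp

lemma ln_over_Phi_inv_sq: "((\<lambda>y. ln (1 / y) / (Phi_inv y)\<^sup>2) \<longlongrightarrow> 1 / 2) (at_right 0)"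
proof -
  have "filterlim (\<lambda>y. - Phi_inv y) at_top (at_right 0)"
    using Phi_inv_at_bot by (simp add: filterlim_uminus_at_bot)
  from filterlim_compose[OF ln_Phi_uminus_asymp this]
  have "((\<lambda>y. ln (1 / Phi (Phi_inv y)) / (Phi_inv y)\<^sup>2) \<longlongrightarrow> 1 / 2) (at_right 0)" by simp
  moreover have "\<forall>\<^sub>F y in at_right 0. y \<in> {0<..<1::real}"
    by (intro eventually_at_right_real) simp
  then have "\<forall>\<^sub>F y in at_right 0. ln (1 / Phi (Phi_inv y)) / (Phi_inv y)\<^sup>2 = ln (1 / y) / (Phi_inv y)\<^sup>2"
    by eventually_elim (simp add: Phi_Phi_inv)
  ultimately show ?thesis by (rule Lim_transform_eventually)
qed

section \<open>The lower bound 1/4\<close>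

lemma x_ln_x_ge:
  fixes x :: real
  assumes "0 < x"
  shows "x - 1 \<le> x * ln x"
proof -
  have "ln (1 / x) \<le> 1 / x - 1" using assms by (intro ln_le_minus_one) simp
  then show ?thesis using assms by (simp add: ln_div field_simps)
qed

lemma diagonal_bound:
  assumes "0 < y" "y < 1 / 2"
  shows "(Phi_inv y)\<^sup>2 / 2 \<le> (1 - 2 * y) * ln ((1 - y) / y)"
proof -
  have "4 * (1 - y) * y \<le> exp (- (Phi_inv y)\<^sup>2 / 2)"
    using Phi_variance_le[of "- Phi_inv y"] Phi_inv_neg[OF assms] Phi_Phi_inv[of y] assms
    by (simp add: Phi_uminus)
  then have "ln ((2 * (1 - y)) * (2 * y)) \<le> ln (exp (- (Phi_inv y)\<^sup>2 / 2))"
    using assms by (subst ln_le_cancel_iff) (auto simp: mult_ac)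
  moreover define A B where "A = ln (2 * (1 - y))" and "B = ln (2 * y)"
  ultimately have 1: "(Phi_inv y)\<^sup>2 / 2 \<le> - A - B"
    using assms ln_mult[of "2 * (1 - y)" "2 * y"] by simp
  \<comment> \<open>This is twice the relative entropy of \<open>(1 - y, y)\<close> with respect to
    the uniform distribution, and equals \<open>(1 - 2 * y) * (A - B) - (- A - B)\<close>. The
    arguments \<open>2 * (1 - y)\<close> and \<open>2 * y\<close> add up to 2, so the linear lower
    bounds cancel.\<close>
  have "2 * (1 - y) * A + 2 * y * B \<ge> 0"
    using x_ln_x_ge[of "2 * (1 - y)"] x_ln_x_ge[of "2 * y"] assms by (simp add: A_def B_def)
  moreover have D: "ln ((1 - y) / y) = A - B"
    using assms ln_div[of "2 * (1 - y)" "2 * y"] unfolding A_def B_def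
    by (subst (asm) mult_divide_mult_cancel_left) auto
  ultimately show ?thesis using 1 unfolding D by (simp add: algebra_simps)
qed

lemma omega_add_omega:
  assumes "0 < \<alpha>" "\<alpha> < 1" "0 < \<beta>" "\<beta> < 1"
  shows "omega \<alpha> \<beta> + omega \<beta> \<alpha> = (1 - \<alpha> - \<beta>) * (ln ((1 - \<alpha>) / \<alpha>) + ln ((1 - \<beta>) / \<beta>)) / 2"
  using assms by (simp add: omega_def ln_div field_simps)

lemma sample_size_pos:
  assumes "0 < \<alpha>" "\<alpha> < 1 / 2" "0 < \<beta>" "\<beta> < 1 / 2"
  shows "0 < sample_size \<alpha> \<beta>"
  using Phi_inv_neg[of \<alpha>] Phi_inv_neg[of \<beta>] assms by (simp add: sample_size_def)

text \<open>The maximum is at least the mean of the two values of \<open>omega\<close>, which is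
  \<open>(u + v) * (L + M) / 8\<close>. It remains to bound \<open>(a + b)\<^sup>2 / 2\<close> by
  \<open>(u + v) * (L + M)\<close>: the squares are handled by \<open>diagonal_bound\<close>, the
  cross term \<open>a * b\<close> by multiplying the two diagonal bounds.\<close>

lemma efficiency_ge:
  assumes "0 < \<alpha>" "\<alpha> < 1 / 2" "0 < \<beta>" "\<beta> < 1 / 2"
  shows "1 / 4 \<le> efficiency \<alpha> \<beta>"
proof -
  define a b where "a = - Phi_inv \<alpha>" and "b = - Phi_inv \<beta>"
  define u v where "u = 1 - 2 * \<alpha>" and "v = 1 - 2 * \<beta>"
  define L M where "L = ln ((1 - \<alpha>) / \<alpha>)" and "M = ln ((1 - \<beta>) / \<beta>)"
  have pos: "0 < a" "0 < b" "0 < u" "0 < v" "0 < L" "0 < M"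
    using assms Phi_inv_neg[of \<alpha>] Phi_inv_neg[of \<beta>]
    by (auto simp: a_def b_def u_def v_def L_def M_def intro!: ln_gt_zero)
  have diag: "a\<^sup>2 / 2 \<le> u * L" "b\<^sup>2 / 2 \<le> v * M"
    using diagonal_bound[of \<alpha>] diagonal_bound[of \<beta>] assms
    by (simp_all add: a_def b_def u_def v_def L_def M_def)
  \<comment> \<open>Cauchy--Schwarz for \<open>(u + v) * (L + M)\<close>, so that the diagonal case suffices\<close>
  have "(a * b)\<^sup>2 \<le> (u * M + v * L)\<^sup>2"
  proof -
    have "(a * b)\<^sup>2 = 4 * ((a\<^sup>2 / 2) * (b\<^sup>2 / 2))" by (simp add: power_mult_distrib)
    also have "\<dots> \<le> 4 * ((u * L) * (v * M))"
      using diag pos by (intro mult_left_mono mult_mono) auto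
    \<comment> \<open>The product is regrouped as \<open>(u * M) * (v * L)\<close>, to which the
      inequality of arithmetic and geometric means applies.\<close>
    also have "\<dots> = (u * M + v * L)\<^sup>2 - (u * M - v * L)\<^sup>2"
      by (simp add: power2_eq_square algebra_simps)
    also have "\<dots> \<le> (u * M + v * L)\<^sup>2" by simp
    finally show ?thesis .
  qed
  then have "a * b \<le> u * M + v * L"
    using pos by (simp add: power2_le_iff_abs_le)
  then have "(a + b)\<^sup>2 / 2 \<le> (u + v) * (L + M)"
    using diag by (simp add: power2_eq_square algebra_simps)
  also have "\<dots> = 4 * (omega \<alpha> \<beta> + omega \<beta> \<alpha>)"
    using assms by (subst omega_add_omega) (auto simp: u_def v_def L_def M_def algebra_simps)
  finally have "(a + b)\<^sup>2 / 16 \<le> max (omega \<alpha> \<beta>) (omega \<beta> \<alpha>)" by simp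
  moreover have "sample_size \<alpha> \<beta> = (a + b)\<^sup>2 / 4"
    by (simp add: sample_size_def a_def b_def power2_eq_square algebra_simps)
  ultimately show ?thesis
    using sample_size_pos[OF assms] by (simp add: efficiency_def pos_le_divide_eq)
qed

section \<open>Upper bounds for the efficiency\<close>

lemma omega_le:
  assumes "0 < \<alpha>" "\<alpha> < 1 / 2" "0 < \<beta>" "\<beta> < 1 / 2"
  shows "omega \<alpha> \<beta> \<le> ln (1 / \<beta>) / 2"
proof -
  have "\<alpha> * ln (\<alpha> / (1 - \<beta>)) \<le> 0"
    using assms by (intro mult_nonneg_nonpos) auto
  moreover have "(1 - \<alpha>) * ln ((1 - \<alpha>) / \<beta>) \<le> 1 * ln (1 / \<beta>)"
    using assms by (intro mult_mono) (auto simp: field_simps)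
  ultimately show ?thesis by (simp add: omega_def)
qed

text \<open>Both quantiles are negative, so dropping \<open>Phi_inv \<alpha>\<close> can only shrink
  the square in the denominator.\<close>

lemma omega_over_sample_size_le:
  assumes "0 < \<alpha>" "\<alpha> < 1 / 2" "0 < \<beta>" "\<beta> < 1 / 2"
  shows "omega \<alpha> \<beta> / sample_size \<alpha> \<beta> \<le> 2 * (ln (1 / \<beta>) / (Phi_inv \<beta>)\<^sup>2)"
proof -
  have neg: "Phi_inv \<alpha> < 0" "Phi_inv \<beta> < 0" using assms by (auto intro: Phi_inv_neg)
  have "(- Phi_inv \<beta>)\<^sup>2 \<le> (- Phi_inv \<alpha> - Phi_inv \<beta>)\<^sup>2"
    using neg by (intro power_mono) auto
  then have "(Phi_inv \<beta>)\<^sup>2 / 4 \<le> sample_size \<alpha> \<beta>"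
    by (simp add: sample_size_def power2_eq_square algebra_simps)
  then have "omega \<alpha> \<beta> / sample_size \<alpha> \<beta> \<le> (ln (1 / \<beta>) / 2) / ((Phi_inv \<beta>)\<^sup>2 / 4)"
    using omega_le[OF assms] neg assms by (intro frac_le) auto
  then show ?thesis by simp
qed

lemma efficiency_le:
  assumes "0 < \<alpha>" "\<alpha> < 1 / 2" "0 < \<beta>" "\<beta> < 1 / 2"
  shows "efficiency \<alpha> \<beta> \<le> 2 * max (ln (1 / \<alpha>) / (Phi_inv \<alpha>)\<^sup>2) (ln (1 / \<beta>) / (Phi_inv \<beta>)\<^sup>2)"
  using omega_over_sample_size_le[OF assms] omega_over_sample_size_le[of \<beta> \<alpha>] assms
  unfolding efficiency_def
  by (simp add: max_def sample_size_def add.commute split: if_splits)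

section \<open>Limits along an edge and along the diagonal\<close>

text \<open>Numerator and denominator are compared with \<open>ln (1 / \<beta>)\<close>:
  \<open>omega \<alpha> \<beta>\<close> contributes \<open>(1 - \<alpha>) / 2\<close>,
  \<open>omega \<beta> \<alpha>\<close> stays bounded, and the fixed quantile
  \<open>Phi_inv \<alpha>\<close> is negligible against \<open>Phi_inv \<beta>\<close>.\<close>

lemma efficiency_tendsto:
  assumes "0 < \<alpha>" "\<alpha> < 1 / 2"
  shows "((\<lambda>\<beta>. efficiency \<alpha> \<beta>) \<longlongrightarrow> 1 - \<alpha>) (at_right 0)"
proof -
  let ?l = "\<lambda>\<beta>::real. ln (1 / \<beta>)"
  have om1: "((\<lambda>\<beta>. omega \<alpha> \<beta> / ?l \<beta>) \<longlongrightarrow> (1 - \<alpha>) / 2) (at_right 0)"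
    unfolding omega_def using assms by real_asymp
  have om2: "((\<lambda>\<beta>. omega \<beta> \<alpha> / ?l \<beta>) \<longlongrightarrow> 0) (at_right 0)"
    unfolding omega_def using assms by real_asymp
  have neg: "\<forall>\<^sub>F \<beta> in at_right 0. \<beta> \<in> {0<..<1/2::real}"
    by (intro eventually_at_right_real) simp
  have "((\<lambda>\<beta>. Phi_inv \<alpha> / Phi_inv \<beta>) \<longlongrightarrow> 0) (at_right 0)"
    by (intro tendsto_divide_0[OF tendsto_const] filterlim_at_bot_imp_at_infinity Phi_inv_at_bot)
  then have "((\<lambda>\<beta>. (Phi_inv \<alpha> / Phi_inv \<beta> + 1)\<^sup>2 / (4 * (?l \<beta> / (Phi_inv \<beta>)\<^sup>2)))
      \<longlongrightarrow> (0 + 1)\<^sup>2 / (4 * (1 / 2))) (at_right 0)"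
    by (intro tendsto_intros ln_over_Phi_inv_sq) auto
  moreover have "\<forall>\<^sub>F \<beta> in at_right 0.
      (Phi_inv \<alpha> / Phi_inv \<beta> + 1)\<^sup>2 / (4 * (?l \<beta> / (Phi_inv \<beta>)\<^sup>2)) = sample_size \<alpha> \<beta> / ?l \<beta>"
    using neg
  proof eventually_elim
    case (elim \<beta>)
    then have "Phi_inv \<beta> \<noteq> 0" "?l \<beta> \<noteq> 0" using Phi_inv_neg[of \<beta>] by auto
    then show ?case by (simp add: sample_size_def power2_eq_square field_simps)
  qed
  ultimately have ss: "((\<lambda>\<beta>. sample_size \<alpha> \<beta> / ?l \<beta>) \<longlongrightarrow> 1 / 2) (at_right 0)"
    by (auto dest: Lim_transform_eventually)
  have "((\<lambda>\<beta>. max (omega \<alpha> \<beta> / ?l \<beta>) (omega \<beta> \<alpha> / ?l \<beta>) / (sample_size \<alpha> \<beta> / ?l \<beta>))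
      \<longlongrightarrow> max ((1 - \<alpha>) / 2) 0 / (1 / 2)) (at_right 0)"
    by (intro tendsto_divide tendsto_max om1 om2 ss) simp
  also have "max ((1 - \<alpha>) / 2) 0 / (1 / 2) = 1 - \<alpha>"
    using assms by simp
  finally have "((\<lambda>\<beta>. max (omega \<alpha> \<beta> / ?l \<beta>) (omega \<beta> \<alpha> / ?l \<beta>) / (sample_size \<alpha> \<beta> / ?l \<beta>))
      \<longlongrightarrow> 1 - \<alpha>) (at_right 0)" .
  moreover have "\<forall>\<^sub>F \<beta> in at_right 0.
      max (omega \<alpha> \<beta> / ?l \<beta>) (omega \<beta> \<alpha> / ?l \<beta>) / (sample_size \<alpha> \<beta> / ?l \<beta>) = efficiency \<alpha> \<beta>"
    using neg
  proof eventually_elim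
    case (elim \<beta>)
    then have l: "0 < ?l \<beta>" by (auto intro!: ln_gt_zero)
    \<comment> \<open>Division by a positive number commutes with \<open>max\<close>.\<close>
    then have "max (omega \<alpha> \<beta> / ?l \<beta>) (omega \<beta> \<alpha> / ?l \<beta>) = max (omega \<alpha> \<beta>) (omega \<beta> \<alpha>) / ?l \<beta>"
      by (simp add: max_def divide_le_cancel)
    with l show ?case by (simp add: efficiency_def)
  qed
  ultimately show ?thesis by (rule Lim_transform_eventually)
qed

lemma efficiency_diagonal_tendsto: "((\<lambda>y. efficiency y y) \<longlongrightarrow> 1 / 4) (at_right 0)"
proof -
  have "((\<lambda>y::real. omega y y / ln (1 / y)) \<longlongrightarrow> 1 / 2) (at_right 0)"
    unfolding omega_def by real_asymp
  then have "((\<lambda>y. (omega y y / ln (1 / y)) * (ln (1 / y) / (Phi_inv y)\<^sup>2)) \<longlongrightarrow> 1 / 2 * (1 / 2)) (at_right 0)"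
    by (intro tendsto_mult ln_over_Phi_inv_sq)
  moreover have "\<forall>\<^sub>F y in at_right 0. y \<in> {0<..<1/2::real}"
    by (intro eventually_at_right_real) simp
  then have "\<forall>\<^sub>F y in at_right 0.
      (omega y y / ln (1 / y)) * (ln (1 / y) / (Phi_inv y)\<^sup>2) = efficiency y y"
  proof eventually_elim
    case (elim y)
    then have "ln (1 / y) \<noteq> 0" by auto
    then show ?case by (simp add: efficiency_def sample_size_def power2_eq_square)
  qed
  ultimately show ?thesis by (auto dest: Lim_transform_eventually)
qed

section \<open>Lower and upper limits at the corner of the square\<close>

abbreviation (input) at_origin :: "(real \<times> real) filter" where
  "at_origin \<equiv> at (0, 0) within {0<..<1/2} \<times> {0<..<1/2}"

lemma filterlim_diagonal: "filterlim (\<lambda>y. (y, y)) at_origin (at_right 0)"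
proof -
  have "\<forall>\<^sub>F y in at_right 0. y \<in> {0<..<1/2::real}"
    by (intro eventually_at_right_real) simp
  then have "\<forall>\<^sub>F y in at_right 0. (y, y) \<in> {0<..<1/2::real} \<times> {0<..<1/2::real} \<and> (y, y) \<noteq> (0, 0)"
    by eventually_elim auto
  then show ?thesis
    by (auto simp: filterlim_at intro!: tendsto_Pair tendsto_ident_at)
qed

text \<open>The condition \<open>p \<noteq> (0, 0)\<close> is absent because the origin lies outside
  the open square.\<close>

lemma eventually_at_origin:
  "(\<forall>\<^sub>F p in at_origin. P p) \<longleftrightarrow>
    (\<exists>d>0. \<forall>p\<in>{0<..<1/2} \<times> {0<..<1/2}. dist p (0, 0) < d \<longrightarrow> P p)"
  by (auto simp: eventually_at)

lemma eventually_in_at_origin: "\<forall>\<^sub>F p in at_origin. p \<in> {0<..<1/2} \<times> {0<..<1/2}"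
  by (simp add: eventually_at_filter)

text \<open>The diagonal carries the nontrivial filter \<open>at_right 0\<close> into
  \<open>at_origin\<close>. Nontriviality lets \<open>Limsup\<close> be read off from a
  limit.\<close>

lemma at_origin_neq_bot: "at_origin \<noteq> bot"
proof
  assume "at_origin = bot"
  then have "filterlim (\<lambda>y. (y, y)) bot (at_right (0::real))"
    using filterlim_diagonal by simp
  then show False by (simp add: filterlim_def bot_unique filtermap_bot_iff)
qed

lemma Liminf_efficiency:
  "Liminf at_origin (\<lambda>(\<alpha>, \<beta>). ereal (efficiency \<alpha> \<beta>)) = ereal (1 / 4)"
proof (rule antisym)
  show "ereal (1 / 4) \<le> Liminf at_origin (\<lambda>(\<alpha>, \<beta>). ereal (efficiency \<alpha> \<beta>))"
  proof (rule Liminf_bounded)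
    show "\<forall>\<^sub>F p in at_origin. ereal (1 / 4) \<le> (case p of (\<alpha>, \<beta>) \<Rightarrow> ereal (efficiency \<alpha> \<beta>))"
      using eventually_in_at_origin by eventually_elim (use efficiency_ge in force)
  qed
next
  have lim: "((\<lambda>y. ereal (efficiency y y)) \<longlongrightarrow> ereal (1 / 4)) (at_right 0)"
    using efficiency_diagonal_tendsto by simp
  show "Liminf at_origin (\<lambda>(\<alpha>, \<beta>). ereal (efficiency \<alpha> \<beta>)) \<le> ereal (1 / 4)"
  proof (rule ccontr)
    assume "\<not> ?thesis"
    \<comment> \<open>The efficiency would eventually exceed \<open>y\<close> on the whole square,
      hence also along the diagonal, where it tends to \<open>1 / 4 < y\<close>.\<close>
    then obtain y where y: "ereal (1 / 4) < y"
        "y < Liminf at_origin (\<lambda>(\<alpha>, \<beta>). ereal (efficiency \<alpha> \<beta>))"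
      using dense by (meson not_le)
    from less_LiminfD[OF y(2)] have "\<forall>\<^sub>F p in at_origin. y < (case p of (\<alpha>, \<beta>) \<Rightarrow> ereal (efficiency \<alpha> \<beta>))" .
    with filterlim_diagonal have "\<forall>\<^sub>F x in at_right 0. y < ereal (efficiency x x)"
      by (auto simp: filterlim_iff)
    with order_tendstoD(2)[OF lim y(1)] have "\<forall>\<^sub>F x in at_right (0::real). False"
      by eventually_elim simp
    then show False by simp
  qed
qed

lemma Limsup_efficiency:
  "Limsup at_origin (\<lambda>(\<alpha>, \<beta>). ereal (efficiency \<alpha> \<beta>)) = 1"
proof (rule antisym)
  let ?r = "\<lambda>y. ln (1 / y) / (Phi_inv y)\<^sup>2"
  have fst: "filterlim fst (at_right 0) at_origin" and snd: "filterlim snd (at_right 0) at_origin"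
  proof -
    have "(fst \<longlongrightarrow> (0::real)) at_origin" "(snd \<longlongrightarrow> (0::real)) at_origin"
      by (rule tendsto_eq_intros tendsto_ident_at | simp)+
    moreover have "\<forall>\<^sub>F p in at_origin. fst p \<in> {0<..} \<and> fst p \<noteq> 0"
        "\<forall>\<^sub>F p in at_origin. snd p \<in> {0<..} \<and> snd p \<noteq> 0"
      by (rule eventually_mono[OF eventually_in_at_origin], auto)+
    ultimately show "filterlim fst (at_right 0) at_origin" "filterlim snd (at_right 0) at_origin"
      by (auto simp: filterlim_at)
  qed
  \<comment> \<open>Both coordinates tend to 0 from the right, so the majorant from
    \<open>efficiency_le\<close> tends to 1.\<close>
  have "((\<lambda>p. 2 * max (?r (fst p)) (?r (snd p))) \<longlongrightarrow> 2 * max (1 / 2) (1 / 2)) at_origin"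
    by (intro tendsto_mult tendsto_const tendsto_max
        filterlim_compose[OF ln_over_Phi_inv_sq fst] filterlim_compose[OF ln_over_Phi_inv_sq snd])
  then have lim: "((\<lambda>p. ereal (2 * max (?r (fst p)) (?r (snd p)))) \<longlongrightarrow> 1) at_origin"
    by (simp add: one_ereal_def)
  have "Limsup at_origin (\<lambda>(\<alpha>, \<beta>). ereal (efficiency \<alpha> \<beta>))
      \<le> Limsup at_origin (\<lambda>p. ereal (2 * max (?r (fst p)) (?r (snd p))))"
  proof (rule Limsup_mono)
    show "\<forall>\<^sub>F p in at_origin. (case p of (\<alpha>, \<beta>) \<Rightarrow> ereal (efficiency \<alpha> \<beta>))
        \<le> ereal (2 * max (?r (fst p)) (?r (snd p)))"
      using eventually_in_at_origin
    proof eventually_elim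
      case (elim p)
      then show ?case using efficiency_le[of "fst p" "snd p"] by (auto simp: mem_Times_iff split_beta)
    qed
  qed
  also have "\<dots> = 1"
    by (rule lim_imp_Limsup[OF at_origin_neq_bot lim])
  finally show "Limsup at_origin (\<lambda>(\<alpha>, \<beta>). ereal (efficiency \<alpha> \<beta>)) \<le> 1" .
next
  show "1 \<le> Limsup at_origin (\<lambda>(\<alpha>, \<beta>). ereal (efficiency \<alpha> \<beta>))"
  proof (rule ccontr)
    assume "\<not> ?thesis"
    then obtain z where z: "Limsup at_origin (\<lambda>(\<alpha>, \<beta>). ereal (efficiency \<alpha> \<beta>)) < ereal z" "ereal z < 1"
      using ereal_dense2 by (meson not_le)
    then have "z < 1" by (simp add: one_ereal_def)
    from Limsup_lessD[OF z(1)] obtain d where d: "d > 0"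
        "\<And>\<alpha> \<beta>. \<alpha> \<in> {0<..<1/2} \<Longrightarrow> \<beta> \<in> {0<..<1/2} \<Longrightarrow> dist (\<alpha>, \<beta>) (0, 0) < d \<Longrightarrow> efficiency \<alpha> \<beta> < z"
      unfolding eventually_at_origin by force
    \<comment> \<open>The three terms keep \<alpha> inside the square, leave half of the radius
      \<open>d\<close> for \<beta>, and put the edge limit \<open>1 - \<alpha>\<close> above
      \<open>z\<close>. A small enough \<beta> then contradicts the choice of
      \<open>d\<close>.\<close>
    define \<alpha> where "\<alpha> = min (1 / 4) (min (d / 2) ((1 - z) / 2))"
    have \<alpha>: "0 < \<alpha>" "\<alpha> < 1 / 2" "\<alpha> \<le> d / 2" "z < 1 - \<alpha>"
      using d(1) \<open>z < 1\<close> by (auto simp: \<alpha>_def min_def field_simps)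
    have "\<forall>\<^sub>F \<beta> in at_right 0. \<beta> \<in> {0<..<min (1/2) (d / 2)}"
      using d(1) by (intro eventually_at_right_real) simp
    with order_tendstoD(1)[OF efficiency_tendsto[OF \<alpha>(1,2)] \<alpha>(4)]
    have "\<forall>\<^sub>F \<beta> in at_right (0::real). False"
    proof eventually_elim
      case (elim \<beta>)
      have "dist (\<alpha>, \<beta>) (0, 0) \<le> \<bar>\<alpha>\<bar> + \<bar>\<beta>\<bar>"
        by (simp add: dist_Pair_Pair sqrt_sum_squares_le_sum_abs)
      also have "\<dots> < d" using elim \<alpha> by simp
      finally show ?case using d(2)[of \<alpha> \<beta>] elim \<alpha> by simp
    qed
    then show False by simp
  qed
qed

theorem mainTheorem4:
  shows "(\<forall>\<alpha>\<in>{0<..<1/2}. \<forall>\<beta>\<in>{0<..<1/2}. efficiency \<alpha> \<beta> \<ge> 1 / 4)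
    \<and> (\<forall>\<alpha>\<in>{0<..<1/2}. ((\<lambda>\<beta>. efficiency \<alpha> \<beta>) \<longlongrightarrow> 1 - \<alpha>) (at_right 0))
    \<and> (Liminf (at (0, 0) within {0<..<1/2} \<times> {0<..<1/2}) (\<lambda>(\<alpha>, \<beta>). ereal (efficiency \<alpha> \<beta>)) = ereal (1 / 4)
      \<and> ereal (1 / 4) < 1
      \<and> 1 = Limsup (at (0, 0) within {0<..<1/2} \<times> {0<..<1/2}) (\<lambda>(\<alpha>, \<beta>). ereal (efficiency \<alpha> \<beta>)))"
  using efficiency_ge efficiency_tendsto Liminf_efficiency Limsup_efficiency
  by (auto simp: one_ereal_def)

end
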